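(* For $n\geqslant 1$ let $\mathfrak{S}_n$ be the set of permutations $\pi=\pi(1)\pi(2)\cdots\pi(n)$ of $[n]=\{1,\ldots,n\}$, and define $$A_n(x,y,s)=\sum_{\pi\in\mathfrak{S}_n}x^{\mathrm{basc}(\pi)}y^{\mathrm{des}(\pi)}s^{\mathrm{suc}(\pi)},\qquad A_0(x,y,s)=1,$$ where $\mathrm{des}(\pi)=\#\{i\in[n-1]:\pi(i)>\pi(i+1)\}$, $\mathrm{basc}(\pi)=\#\{i\in[n-1]:\pi(i+1)\geqslant \pi(i)+2\}$ and $\mathrm{suc}(\pi)=\#\{i\in[n-1]:\pi(i+1)=\pi(i)+1\}$. Then: (i) $$\sum_{n=0}^{\infty}A_{n+1}(x,y,s)\frac{z^n}{n!}=\mathrm{e}^{z(y+s)}\left(\frac{y-x}{y\mathrm{e}^{xz}-x\mathrm{e}^{yz}}\right)^2;$$ (ii) for every $n\geqslant 0$, $$A_{n+1}(x,y,s)=\sum_{i=0}^n(s+y)^i\sum_{j=0}^{\lfloor (n-i)/2\rfloor}\gamma_{n,i,j}(2xy)^j(x+y)^{n-i-2j},$$ where the numbers $\gamma_{n,i,j}$ are determined by $\gamma_{0,0,0}=1$, $\gamma_{0,i,j}=0$ for $(i,j)\neq(0,0)$ (and $\gamma_{n,i,j}=0$ whenever an index is negative), and the recurrence $$\gamma_{n+1,i,j}=\gamma_{n,i-1,j}+(1+i)\gamma_{n,i+1,j-1}+j\gamma_{n,i,j}+(n-i-2j+2)\gamma_{n,i,j-1};$$ (iii) $\gamma_{n,i,j}$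 equals the number of 0-1-2 increasing rooted forests on $\{0,1,\ldots,n\}$ with $i+j$ leaves, among which exactly $i$ leaves are children of the root $0$.
   Context: An increasing tree on $\{0,1,\ldots,n\}$ is a rooted (non-plane, i.e. children unordered) tree with vertex set $\{0,1,\ldots,n\}$ and root $0$, in which labels increase along every path from the root to a leaf. The degree of a vertex is its number of children. A 0-1-2 increasing rooted forest on $\{0,1,\ldots,n\}$ is an increasing tree on $\{0,1,\ldots,n\}$ in which every child of the root $0$ has degree $0$ or $1$, and every vertex other than the root has degree at most two. A leaf is a non-root vertex of degree $0$. *)

theory Defs
  imports
    "HOL-Combinatorics.Permutations"
    "HOL-Computational_Algebra.Formal_Power_Series"
begin

definition des :: "nat \<Rightarrow> (nat \<Rightarrow> nat) \<Rightarrow> nat" where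
  "des n \<pi> = card {i \<in> {1..<n}. \<pi> i > \<pi> (i + 1)}"

definition basc :: "nat \<Rightarrow> (nat \<Rightarrow> nat) \<Rightarrow> nat" where
  "basc n \<pi> = card {i \<in> {1..<n}. \<pi> (i + 1) \<ge> \<pi> i + 2}"

definition suc :: "nat \<Rightarrow> (nat \<Rightarrow> nat) \<Rightarrow> nat" where
  "suc n \<pi> = card {i \<in> {1..<n}. \<pi> (i + 1) = \<pi> i + 1}"

definition A :: "nat \<Rightarrow> 'a::comm_semiring_1 \<Rightarrow> 'a \<Rightarrow> 'a \<Rightarrow> 'a" where
  "A n x y s = (\<Sum>\<pi> | \<pi> permutes {1..n}. x ^ basc n \<pi> * y ^ des n \<pi> * s ^ suc n \<pi>)"

lemma A_0: "A 0 x y s = 1"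
  by (simp add: A_def basc_def des_def suc_def)

text \<open>The indices \<open>i\<close>, \<open>j\<close> and the values are integers, so that the index shifts and the
  coefficient \<open>n - i - 2 j + 2\<close> of the recurrence are not truncated.\<close>

primrec \<gamma> :: "nat \<Rightarrow> int \<Rightarrow> int \<Rightarrow> int" where
  "\<gamma> 0 i j = (if i = 0 \<and> j = 0 then 1 else 0)"
| "\<gamma> (Suc n) i j =
    (if i < 0 \<or> j < 0 then 0
     else \<gamma> n (i - 1) j + (1 + i) * \<gamma> n (i + 1) (j - 1) + j * \<gamma> n i j
        + (int n - i - 2 * j + 2) * \<gamma> n i (j - 1))"

lemma \<gamma>_neg: "i < 0 \<or> j < 0 \<Longrightarrow> \<gamma> n i j = 0"
  by (cases n) auto

text \<open>A rooted tree on the vertex set \<open>V\<close> with root \<open>r\<close> is represented by its set \<open>T\<close> of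
  (parent, child) arcs; children are thereby unordered.\<close>

definition rooted_tree :: "'v set \<Rightarrow> 'v \<Rightarrow> ('v \<times> 'v) set \<Rightarrow> bool" where
  "rooted_tree V r T \<longleftrightarrow>
     r \<in> V \<and> T \<subseteq> V \<times> V \<and>
     (\<nexists>u. (u, r) \<in> T) \<and>
     (\<forall>v \<in> V - {r}. \<exists>!u. (u, v) \<in> T) \<and>
     (\<forall>v \<in> V. (r, v) \<in> T\<^sup>*)"

definition children :: "('v \<times> 'v) set \<Rightarrow> 'v \<Rightarrow> 'v set" where
  "children T u = {v. (u, v) \<in> T}"

definition vdegree :: "('v \<times> 'v) set \<Rightarrow> 'v \<Rightarrow> nat" where
  "vdegree T u = card (children T u)"

text \<open>In a rooted tree, \<open>(u, v) \<in> T\<^sup>+\<close> says that \<open>u\<close> strictly precedes \<open>v\<close> on a path from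
  the root to a leaf.\<close>

definition increasing_tree :: "nat \<Rightarrow> (nat \<times> nat) set \<Rightarrow> bool" where
  "increasing_tree n T \<longleftrightarrow> rooted_tree {0..n} 0 T \<and> (\<forall>(u, v) \<in> T\<^sup>+. u < v)"

definition forest_012 :: "nat \<Rightarrow> (nat \<times> nat) set \<Rightarrow> bool" where
  "forest_012 n T \<longleftrightarrow>
     increasing_tree n T \<and>
     (\<forall>v \<in> children T 0. vdegree T v \<in> {0, 1}) \<and>
     (\<forall>v \<in> {0..n} - {0}. vdegree T v \<le> 2)"

definition leaves :: "nat \<Rightarrow> (nat \<times> nat) set \<Rightarrow> nat set" where
  "leaves n T = {v \<in> {0..n} - {0}. vdegree T v = 0}"

end

theory Submission
  imports Defs "HOL-Combinatorics.Multiset_Permutations"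
begin

text \<open>Let \<open>X, Y, S\<close> be power series in \<open>z\<close> with \<open>X' = Y' = S' = X Y\<close> and initial values \<open>x, y, s\<close>.
  Inserting \<open>n + 1\<close> into a permutation of \<open>{1..n}\<close> in front multiplies its weight by \<open>Y\<close>, and right
  after \<open>n\<close> by \<open>S\<close>; the other insertions replace one factor of the weight by \<open>X Y\<close>, each factor
  exactly once, and so add up to the derivative of the weight. Hence
  \<open>A\<^sub>n\<^sub>+\<^sub>1 = (Y + S) A\<^sub>n + A\<^sub>n'\<close> along the flow. The \<open>\<gamma>\<close>-expansion
  obeys the same law, because \<open>u = S + Y\<close>, \<open>v = 2 X Y\<close>, \<open>w = X + Y\<close> satisfy \<open>u' = w' = v\<close> and
  \<open>v' = v w\<close>; constant terms give (ii). If \<open>G' = (Y + S) G\<close> and \<open>G(0) = 1\<close>, then the \<open>n\<close>-th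
  derivative of \<open>G\<close> is \<open>A\<^sub>n\<^sub>+\<^sub>1 G\<close>, so \<open>G\<close> is the generating function of (i), and the flow is solved
  explicitly. For (iii), the parent of the largest vertex is the root, a leaf below the root, another
  leaf, or a vertex with one child that is not itself a child of the root; these are the four terms of the
  recurrence.\<close>

unbundle fps_syntax

section \<open>Permutations as words\<close>

definition step :: "'a \<Rightarrow> 'a \<Rightarrow> 'a \<Rightarrow> nat \<Rightarrow> nat \<Rightarrow> 'a" where
  "step x y s a b = (if b < a then y else if b = a + 1 then s else x)"

text \<open>The weights live in any commutative semiring, so that they can be power series and be
  differentiated.\<close>

fun word_weight :: "'a::comm_semiring_1 \<Rightarrow> 'a \<Rightarrow> 'a \<Rightarrow> nat list \<Rightarrow> 'a" where
  "word_weight x y s (a # b # w) = step x y s a b * word_weight x y s (b # w)"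
| "word_weight x y s w = 1"

definition insert_at :: "'a \<Rightarrow> 'a list \<Rightarrow> nat \<Rightarrow> 'a list" where
  "insert_at m w k = take k w @ m # drop k w"

lemma insert_at_0 [simp]: "insert_at m w 0 = m # w"
  by (simp add: insert_at_def)

lemma insert_at_Suc [simp]: "insert_at m (a # w) (Suc k) = a # insert_at m w k"
  by (simp add: insert_at_def)

lemma word_weight_map_upt:
  "word_weight x y s (map p [Suc 0..<Suc n]) = (\<Prod>i\<in>{1..<n}. step x y s (p i) (p (Suc i)))"
proof -
  \<comment> \<open>The recursion of \<open>word_weight\<close> strips the first letter, so the
    start \<open>k\<close> of the interval has to vary.\<close>
  have "word_weight x y s (map p [k..<k + Suc m]) = (\<Prod>i\<in>{k..<k + m}. step x y s (p i) (p (Suc i)))"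
    for k m
  proof (induction m arbitrary: k)
    case 0
    then show ?case by simp
  next
    case (Suc m)
    have e: "[k..<k + Suc (Suc m)] = k # Suc k # [Suc (Suc k)..<k + Suc (Suc m)]"
      by (simp add: upt_conv_Cons)
    have e': "[Suc k..<Suc k + Suc m] = Suc k # [Suc (Suc k)..<k + Suc (Suc m)]"
      by (simp add: upt_conv_Cons)
    have "{k..<k + Suc m} = insert k {Suc k..<Suc k + m}"
      by auto
    then show ?case
      using Suc[of "Suc k"] unfolding e e' by simp
  qed
  from this[of 1 "n - 1"] show ?thesis
    by (cases n) simp_all
qed

lemma word_weight_permutes:
  assumes "p permutes {1..n}"
  shows "word_weight x y s (map p [1..<Suc n]) = x ^ basc n p * y ^ des n p * s ^ suc n p"
proof -
  have ne: "p i \<noteq> p (Suc i)" for i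
    using permutes_inj[OF assms] by (metis injD n_not_Suc_n)
  \<comment> \<open>Adjacent values differ, so exactly one of the three conditions holds.\<close>
  have "step x y s (p i) (p (Suc i)) =
      (if p (i + 1) \<ge> p i + 2 then x else 1) * (if p i > p (i + 1) then y else 1) *
      (if p (i + 1) = p i + 1 then s else 1)" for i
    using ne[of i] by (auto simp: step_def)
  then show ?thesis
    by (simp add: word_weight_map_upt prod.distrib prod.If_cases basc_def des_def suc_def Int_def
        del: upt_Suc)
qed

lemma bij_betw_permutes_words:
  "bij_betw (\<lambda>p. map p [1..<Suc n]) {p. p permutes {1..n}} (permutations_of_set {1..n})"
proof -
  have inj: "inj_on (\<lambda>p. map p [1..<Suc n]) {p. p permutes {1..n}}"
  proof (rule inj_onI, rule ext)
    fix p q i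
    assume p: "p \<in> {p. p permutes {1..n}}" and q: "q \<in> {p. p permutes {1..n}}"
      and "map p [1..<Suc n] = map q [1..<Suc n]"
    then have "\<forall>i\<in>set [1..<Suc n]. p i = q i"
      by (simp only: map_eq_conv)
    then have "\<forall>i\<in>{1..n}. p i = q i"
      by (simp add: atLeastLessThanSuc_atLeastAtMost del: upt_Suc)
    then show "p i = q i"
      using p q permutes_not_in[of p "{1..n}" i] permutes_not_in[of q "{1..n}" i]
      by (cases "i \<in> {1..n}") simp_all
  qed
  have "(\<lambda>p. map p [1..<Suc n]) ` {p. p permutes {1..n}} \<subseteq> permutations_of_set {1..n}"
  proof
    fix w assume "w \<in> (\<lambda>p. map p [1..<Suc n]) ` {p. p permutes {1..n}}"
    then obtain p where p: "p permutes {1..n}" and w: "w = map p [1..<Suc n]"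
      by blast
    have "set w = {1..n}"
      using permutes_image[OF p] unfolding w
      by (simp add: atLeastLessThanSuc_atLeastAtMost del: upt_Suc)
    moreover have "distinct w"
      using permutes_inj_on[OF p] unfolding w by (simp add: distinct_map del: upt_Suc)
    ultimately show "w \<in> permutations_of_set {1..n}"
      by (rule permutations_of_setI)
  qed
  \<comment> \<open>Both sets have n! elements, so injectivity forces surjectivity.\<close>
  moreover have "card ((\<lambda>p. map p [1..<Suc n]) ` {p. p permutes {1..n}}) =
      card (permutations_of_set {1..n})"
    using card_image[OF inj] card_permutations[of "{1..n}" n] by simp
  ultimately have "(\<lambda>p. map p [1..<Suc n]) ` {p. p permutes {1..n}} = permutations_of_set {1..n}"
    by (intro card_subset_eq) auto
  with inj show ?thesis
    by (simp add: bij_betw_def)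
qed

lemma A_eq_sum_words: "A n x y s = (\<Sum>w\<in>permutations_of_set {1..n}. word_weight x y s w)"
  unfolding A_def
  by (subst sum.reindex_bij_betw[OF bij_betw_permutes_words, symmetric])
    (auto intro!: sum.cong word_weight_permutes[symmetric] simp del: upt_Suc One_nat_def)

text \<open>The inverse deletes \<open>m\<close> and records the number of letters that stood before
  it.\<close>

lemma bij_betw_insert_at:
  assumes "m \<notin> V" "finite V"
  shows "bij_betw (\<lambda>(w, k). insert_at m w k) (permutations_of_set V \<times> {0..card V})
    (permutations_of_set (insert m V))"
proof (rule bij_betwI[where g = "\<lambda>w. (remove1 m w, length (takeWhile (\<lambda>a. a \<noteq> m) w))"])
  show "(\<lambda>(w, k). insert_at m w k) \<in> permutations_of_set V \<times> {0..card V} \<rightarrow>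
      permutations_of_set (insert m V)"
  proof clarify
    fix w k assume w: "w \<in> permutations_of_set V"
    have "set (take k w) \<union> set (drop k w) = set w"
      by (metis append_take_drop_id set_append)
    moreover have "distinct w" "set w = V" "set (take k w) \<inter> set (drop k w) = {}"
      using permutations_of_setD[OF w] by (simp_all add: set_take_disj_set_drop_if_distinct)
    ultimately show "insert_at m w k \<in> permutations_of_set (insert m V)"
      using assms by (intro permutations_of_setI) (auto simp: insert_at_def)
  qed
next
  show "(\<lambda>w. (remove1 m w, length (takeWhile (\<lambda>a. a \<noteq> m) w))) \<in> permutations_of_set (insert m V) \<rightarrow>
      permutations_of_set V \<times> {0..card V}"
  proof
    fix w assume w: "w \<in> permutations_of_set (insert m V)"
    have dw: "distinct w" "set w = insert m V"
      using permutations_of_setD[OF w] by auto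
    then have "length w = Suc (card V)"
      using assms distinct_card by fastforce
    moreover have "length (takeWhile (\<lambda>a. a \<noteq> m) w) < length w"
      using dw by (metis (mono_tags, lifting) insertI1 length_takeWhile_le nat_less_le takeWhile_eq_all_conv
          takeWhile_eq_take take_all_iff order_refl)
    ultimately show "(remove1 m w, length (takeWhile (\<lambda>a. a \<noteq> m) w)) \<in>
        permutations_of_set V \<times> {0..card V}"
      using dw assms by (auto simp: permutations_of_set_def)
  qed
next
  fix z assume "z \<in> permutations_of_set V \<times> {0..card V}"
  then obtain w k where z: "z = (w, k)" and w: "w \<in> permutations_of_set V" and k: "k \<le> card V"
    by auto
  have m: "m \<notin> set w" and l: "length w = card V"
    using w assms permutations_of_setD[OF w] by (auto simp: distinct_card)
  have "m \<notin> set (take k w)"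
    using m by (meson in_set_takeD)
  then show "(\<lambda>w. (remove1 m w, length (takeWhile (\<lambda>a. a \<noteq> m) w)))
      ((\<lambda>(w, k). insert_at m w k) z) = z"
    using z k l by (auto simp: insert_at_def remove1_append takeWhile_append takeWhile_eq_all_conv)
next
  fix w assume "w \<in> permutations_of_set (insert m V)"
  then have "m \<in> set w"
    using permutations_of_setD by fastforce
  then obtain u v where w: "w = u @ m # v" "m \<notin> set u"
    by (meson split_list_first)
  then have "takeWhile (\<lambda>a. a \<noteq> m) w = u"
    by (auto simp: takeWhile_append takeWhile_eq_all_conv)
  then show "(\<lambda>(w, k). insert_at m w k) (remove1 m w, length (takeWhile (\<lambda>a. a \<noteq> m) w)) = w"
    using w by (simp add: remove1_append insert_at_def)
qed

section \<open>Insertion of the largest letter as differentiation\<close>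

locale flow =
  fixes X Y S :: "'a::field_char_0 fps"
  assumes deriv_X: "fps_deriv X = X * Y"
    and deriv_Y: "fps_deriv Y = X * Y"
    and deriv_S: "fps_deriv S = X * Y"
begin

text \<open>The common derivative is also the weight of the two steps, up and then down, that arise
  when \<open>Suc n\<close> enters a gap after a letter below \<open>n\<close>.\<close>

lemma deriv_step: "fps_deriv (step X Y S a b) = X * Y"
  by (simp add: step_def deriv_X deriv_Y deriv_S)

text \<open>A gap after a letter other than \<open>n\<close> turns its factor into
  \<open>X * Y\<close>, the derivative of that factor, and the end of the word contributes
  \<open>X\<close>. If \<open>n\<close> is followed by a letter, its gap gives \<open>S * Y\<close>
  in place of \<open>Y\<close>, hence \<open>S\<close> times the weight, and the \<open>X\<close>
  from the end supplies the missing derivative of that \<open>Y\<close>. If \<open>n\<close> is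
  last, the end contributes \<open>S\<close>.\<close>

lemma sum_insert_after_first:
  assumes "w \<noteq> []" "distinct w" "\<forall>a\<in>set w. a \<le> n"
  shows "(\<Sum>k=1..length w. word_weight X Y S (insert_at (Suc n) w k)) =
    (if n \<in> set w then S else X) * word_weight X Y S w + fps_deriv (word_weight X Y S w)"
  using assms
proof (induction w rule: induct_list012)
  case 1
  then show ?case by simp
next
  case (2 a)
  then show ?case by (auto simp: step_def)
next
  case (3 a b w)
  let ?W = "word_weight X Y S" and ?I = "insert_at (Suc n)"
  have le: "a \<le> n" "b \<le> n" "a \<noteq> b"
    using "3.prems" by auto
  have "(\<Sum>k=1..length (a # b # w). ?W (?I (a # b # w) k)) =
      (\<Sum>k=0..length (b # w). ?W (a # ?I (b # w) k))"
    using sum.shift_bounds_cl_Suc_ivl[of "\<lambda>k. ?W (?I (a # b # w) k)" 0 "length (b # w)"] by simp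
  \<comment> \<open>The term split off fills the gap between \<open>a\<close> and \<open>b\<close>;
    the others leave this pair intact.\<close>
  also have "\<dots> = ?W (a # Suc n # b # w) + (\<Sum>k=1..length (b # w). ?W (a # ?I (b # w) k))"
    by (subst sum.atLeast_Suc_atMost) simp_all
  also have "(\<Sum>k=1..length (b # w). ?W (a # ?I (b # w) k)) =
      (\<Sum>k=1..length (b # w). step X Y S a b * ?W (?I (b # w) k))"
  proof (rule sum.cong[OF refl])
    fix k assume "k \<in> {1..length (b # w)}"
    then obtain k' where "k = Suc k'"
      by (cases k) auto
    then show "?W (a # ?I (b # w) k) = step X Y S a b * ?W (?I (b # w) k)"
      by simp
  qed
  also have "\<dots> = step X Y S a b *
      ((if n \<in> set (b # w) then S else X) * ?W (b # w) + fps_deriv (?W (b # w)))"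
    using 3 by (simp flip: sum_distrib_left)
  also have "?W (a # Suc n # b # w) = (if a = n then S else X) * Y * ?W (b # w)"
    using le by (simp add: step_def)
  finally have eq: "(\<Sum>k=1..length (a # b # w). ?W (?I (a # b # w) k)) =
      (if a = n then S else X) * Y * ?W (b # w) +
      step X Y S a b * ((if n \<in> set (b # w) then S else X) * ?W (b # w) + fps_deriv (?W (b # w)))" .
  show ?case
  proof (cases "a = n")
    case True
    then have "n \<notin> set (b # w)" "step X Y S a b = Y"
      using "3.prems" le by (auto simp: step_def)
    with True show ?thesis
      unfolding eq by (simp add: deriv_Y algebra_simps)
  next
    case False
    then have "n \<in> set (a # b # w) \<longleftrightarrow> n \<in> set (b # w)"
      by auto
    with False show ?thesis
      unfolding eq by (simp add: deriv_step algebra_simps)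
  qed
qed

text \<open>Insertion in front creates a descent, a factor \<open>Y\<close>; the other positions are
  covered by \<open>sum_insert_after_first\<close>, with the previous maximum present. The index
  starts at one because in the empty word the new letter has no neighbour.\<close>

lemma A_Suc: "A (Suc (Suc n)) X Y S = (Y + S) * A (Suc n) X Y S + fps_deriv (A (Suc n) X Y S)"
proof -
  let ?n = "Suc n" and ?W = "word_weight X Y S"
  have ins: "{1..Suc ?n} = insert (Suc ?n) {1..?n}"
    by auto
  have "A (Suc ?n) X Y S =
      (\<Sum>(w, k)\<in>permutations_of_set {1..?n} \<times> {0..card {1..?n}}.
        ?W (insert_at (Suc ?n) w k))"
    unfolding A_eq_sum_words ins
    by (subst sum.reindex_bij_betw[OF bij_betw_insert_at, symmetric]) (auto simp: case_prod_unfold)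
  also have "\<dots> = (\<Sum>w\<in>permutations_of_set {1..?n}. \<Sum>k=0..?n. ?W (insert_at (Suc ?n) w k))"
    unfolding sum.cartesian_product by simp
  also have "\<dots> = (\<Sum>w\<in>permutations_of_set {1..?n}. (Y + S) * ?W w + fps_deriv (?W w))"
  proof (rule sum.cong[OF refl])
    fix w assume "w \<in> permutations_of_set {1..?n}"
    then have w: "distinct w" "set w = {1..?n}"
      by (auto simp: permutations_of_set_def)
    then have l: "length w = ?n"
      using distinct_card by fastforce
    then obtain a v where av: "w = a # v"
      by (cases w) auto
    have "(\<Sum>k=0..?n. ?W (insert_at (Suc ?n) w k)) =
        ?W (Suc ?n # w) + (\<Sum>k=1..length w. ?W (insert_at (Suc ?n) w k))"
      unfolding l by (subst sum.atLeast_Suc_atMost) simp_all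
    also have "?W (Suc ?n # w) = Y * ?W w"
    proof -
      have "a \<in> {1..?n}"
        using w(2) av by auto
      then show ?thesis
        unfolding av by (simp add: step_def)
    qed
    also have "(\<Sum>k=1..length w. ?W (insert_at (Suc ?n) w k)) = S * ?W w + fps_deriv (?W w)"
      by (subst sum_insert_after_first) (use w l in auto)
    finally show "(\<Sum>k=0..?n. ?W (insert_at (Suc ?n) w k)) = (Y + S) * ?W w + fps_deriv (?W w)"
      by (simp add: algebra_simps)
  qed
  finally show ?thesis
    by (simp add: A_eq_sum_words fps_deriv_sum sum.distrib sum_distrib_left)
qed

end

section \<open>The gamma expansion\<close>

lemma gamma_eq_0: "int n < i + 2 * j \<Longrightarrow> \<gamma> n i j = 0"
proof (induction n arbitrary: i j)
  case 0
  then show ?case by auto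
next
  case (Suc n)
  have "\<gamma> n (i - 1) j = 0" "\<gamma> n (i + 1) (j - 1) = 0" "\<gamma> n i j = 0"
    using Suc.prems by (auto intro!: Suc.IH)
  \<comment> \<open>For \<open>i + 2 * j = n + 2\<close> the value of \<open>\<gamma>\<close> need
    not vanish, but its coefficient does.\<close>
  moreover have "(int n - i - 2 * j + 2) * \<gamma> n i (j - 1) = 0"
  proof (cases "int n - i - 2 * j + 2 = 0")
    case False
    then show ?thesis
      using Suc.prems Suc.IH[of i "j - 1"] by simp
  qed simp
  ultimately show ?case by simp
qed

text \<open>Give \<open>u\<close> and \<open>w\<close> weight 1 and \<open>v\<close> weight 2: for
  \<open>i + 2 * j \<le> n\<close> this is a monomial of total weight \<open>n\<close>.\<close>

definition gamma_monomial :: "nat \<Rightarrow> 'a::comm_ring_1 \<Rightarrow> 'a \<Rightarrow> 'a \<Rightarrow> nat \<Rightarrow> nat \<Rightarrow> 'a" where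
  "gamma_monomial n u v w i j = u ^ i * v ^ j * w ^ (n - i - 2 * j)"

text \<open>The expansion (ii) is the case \<open>u = s + y\<close>, \<open>v = 2 * x * y\<close>,
  \<open>w = x + y\<close>.\<close>

definition gamma_sum :: "nat \<Rightarrow> 'a::comm_ring_1 \<Rightarrow> 'a \<Rightarrow> 'a \<Rightarrow> 'a" where
  "gamma_sum n u v w = (\<Sum>i=0..n. u ^ i *
     (\<Sum>j=0..(n - i) div 2. of_int (\<gamma> n (int i) (int j)) * v ^ j * w ^ (n - i - 2 * j)))"

text \<open>Coefficients outside the triangle \<open>i + 2 * j \<le> n\<close> vanish. On a square
  the two indices can be shifted independently.\<close>

lemma gamma_sum_box:
  assumes "n \<le> N"
  shows "gamma_sum n u v w =
    (\<Sum>i\<le>N. \<Sum>j\<le>N. of_int (\<gamma> n (int i) (int j)) * gamma_monomial n u v w i j)"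
proof -
  have "(\<Sum>i\<le>N. \<Sum>j\<le>N. of_int (\<gamma> n (int i) (int j)) * gamma_monomial n u v w i j) =
      (\<Sum>i=0..n. \<Sum>j\<le>N. of_int (\<gamma> n (int i) (int j)) * gamma_monomial n u v w i j)"
    using assms by (intro sum.mono_neutral_right) (auto simp: gamma_eq_0)
  also have "\<dots> = (\<Sum>i=0..n. \<Sum>j=0..(n - i) div 2.
      of_int (\<gamma> n (int i) (int j)) * gamma_monomial n u v w i j)"
  proof (rule sum.cong[OF refl], rule sum.mono_neutral_right)
    fix i assume i: "i \<in> {0..n}"
    show "{0..(n - i) div 2} \<subseteq> {..N}"
      using assms by auto
    show "\<forall>j\<in>{..N} - {0..(n - i) div 2}.
        of_int (\<gamma> n (int i) (int j)) * gamma_monomial n u v w i j = 0"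
    proof
      fix j assume "j \<in> {..N} - {0..(n - i) div 2}"
      then have "n < i + 2 * j"
        using i by auto
      then show "of_int (\<gamma> n (int i) (int j)) * gamma_monomial n u v w i j = 0"
        by (subst gamma_eq_0) auto
    qed
  qed auto
  finally show ?thesis
    by (simp add: gamma_sum_def gamma_monomial_def sum_distrib_left algebra_simps)
qed

text \<open>Product rule: replacing \<open>u\<close> by \<open>v\<close>, \<open>v\<close> by
  \<open>v * w\<close> or \<open>w\<close> by \<open>v\<close> raises the weight by one. The
  truncated \<open>i - 1\<close> is harmless, since its coefficient is zero for
  \<open>i = 0\<close>.\<close>

lemma deriv_gamma_monomial:
  fixes u v w :: "'a::field_char_0 fps"
  assumes u: "fps_deriv u = v" and v: "fps_deriv v = v * w" and w: "fps_deriv w = v"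
    and le: "i + 2 * j \<le> n"
  shows "fps_deriv (gamma_monomial n u v w i j) =
    of_nat i * gamma_monomial (Suc n) u v w (i - 1) (Suc j) +
    of_nat j * gamma_monomial (Suc n) u v w i j +
    of_nat (n - i - 2 * j) * gamma_monomial (Suc n) u v w i (Suc j)"
proof -
  obtain k where n: "n = i + 2 * j + k"
    using le le_Suc_ex by blast
  have 1: "fps_deriv (u ^ i) * v ^ j * w ^ k =
      of_nat i * (u ^ (i - 1) * v ^ Suc j * w ^ (Suc n - (i - 1) - 2 * Suc j))"
    using n by (cases i)
      (simp_all add: fps_deriv_power' u mult_ac del: power_Suc, simp add: mult_ac)
  have 2: "u ^ i * fps_deriv (v ^ j) * w ^ k = of_nat j * (u ^ i * v ^ j * w ^ (Suc n - i - 2 * j))"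
    using n by (cases j)
      (simp_all add: fps_deriv_power' v mult_ac del: power_Suc, simp add: mult_ac)
  have 3: "u ^ i * v ^ j * fps_deriv (w ^ k) =
      of_nat k * (u ^ i * v ^ Suc j * w ^ (Suc n - i - 2 * Suc j))"
    using n by (cases k)
      (simp_all add: fps_deriv_power' w mult_ac del: power_Suc, simp add: mult_ac)
  show ?thesis
    unfolding gamma_monomial_def 1[symmetric] 2[symmetric]
    using n 3 by (simp add: algebra_simps)
qed

lemma sum_shift_up:
  fixes f :: "nat \<Rightarrow> 'a::comm_ring_1"
  assumes "g 0 = 0" "\<And>i. g (Suc i) = f i" "f N = 0"
  shows "(\<Sum>i\<le>N. f i) = (\<Sum>i\<le>N. g i)"
proof (cases N)
  case (Suc M)
  then show ?thesis
    using assms sum.atMost_Suc_shift[of g M] by simp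
qed (use assms in simp)

text \<open>Multiplication by \<open>u\<close> yields the first term of the recurrence;
  differentiating \<open>u\<close>, \<open>v\<close> and \<open>w\<close> yields the second, third
  and fourth.\<close>

lemma gamma_sum_Suc:
  fixes u v w :: "'a::field_char_0 fps"
  assumes u: "fps_deriv u = v" and v: "fps_deriv v = v * w" and w: "fps_deriv w = v"
  shows "gamma_sum (Suc n) u v w = u * gamma_sum n u v w + fps_deriv (gamma_sum n u v w)"
proof -
  \<comment> \<open>One more than \<open>n\<close>: the square serves both sums, and
    \<open>\<gamma> n\<close> vanishes on its last row and column, as the shifts require.\<close>
  define N where "N = Suc n"
  define g where "g i j = (of_int (\<gamma> n i j) :: 'a fps)" for i j
  define M where "M = gamma_monomial (Suc n) u v w"
  have g0: "g (int i) (int j) = 0" if "n < i + 2 * j" for i j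
    using that by (simp add: g_def gamma_eq_0)
  have gneg: "g i j = 0" if "i < 0 \<or> j < 0" for i j
    using that by (simp add: g_def \<gamma>_neg)
  have S: "gamma_sum n u v w = (\<Sum>i\<le>N. \<Sum>j\<le>N. g (int i) (int j) * gamma_monomial n u v w i j)"
    unfolding g_def by (rule gamma_sum_box) (simp add: N_def)
  have "u * gamma_sum n u v w = (\<Sum>i\<le>N. \<Sum>j\<le>N. g (int i) (int j) * M (Suc i) j)"
    unfolding S M_def by (simp add: sum_distrib_left gamma_monomial_def algebra_simps)
  also have "\<dots> = (\<Sum>i\<le>N. \<Sum>j\<le>N. g (int i - 1) (int j) * M i j)"
    by (rule sum_shift_up)
      (auto simp: g_def gamma_eq_0 \<gamma>_neg N_def simp del: sum.atMost_Suc intro!: sum.neutral)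
  finally have 1: "u * gamma_sum n u v w = (\<Sum>i\<le>N. \<Sum>j\<le>N. g (int i - 1) (int j) * M i j)" .
  have "fps_deriv (gamma_sum n u v w) =
    (\<Sum>i\<le>N. \<Sum>j\<le>N. g (int i) (int j) * fps_deriv (gamma_monomial n u v w i j))"
    unfolding S by (simp add: fps_deriv_sum g_def)
  also have "\<dots> = (\<Sum>i\<le>N. \<Sum>j\<le>N.
      of_nat i * g (int i) (int j) * M (i - 1) (Suc j) +
      of_nat j * g (int i) (int j) * M i j +
      of_int (int n - int i - 2 * int j) * g (int i) (int j) * M i (Suc j))"
  proof (intro sum.cong refl)
    fix i j
    show "g (int i) (int j) * fps_deriv (gamma_monomial n u v w i j) =
      of_nat i * g (int i) (int j) * M (i - 1) (Suc j) +
      of_nat j * g (int i) (int j) * M i j +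
      of_int (int n - int i - 2 * int j) * g (int i) (int j) * M i (Suc j)"
    \<comment> \<open>Beyond the triangle the truncated and the integer difference disagree, but
      there \<open>g\<close> vanishes.\<close>
    proof (cases "i + 2 * j \<le> n")
      case True
      then have "int (n - i - 2 * j) = int n - int i - 2 * int j"
        by simp
      then have eq: "of_nat (n - i - 2 * j) = (of_int (int n - int i - 2 * int j) :: 'a fps)"
        by (metis of_int_of_nat_eq)
      show ?thesis
        unfolding deriv_gamma_monomial[OF u v w True] M_def eq by (simp only: distrib_left mult_ac)
    qed (simp add: g0)
  qed
  also have "\<dots> = (\<Sum>i\<le>N. \<Sum>j\<le>N. of_nat i * g (int i) (int j) * M (i - 1) (Suc j)) +
      (\<Sum>i\<le>N. \<Sum>j\<le>N. of_nat j * g (int i) (int j) * M i j) +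
      (\<Sum>i\<le>N. \<Sum>j\<le>N. of_int (int n - int i - 2 * int j) * g (int i) (int j) * M i (Suc j))"
    by (simp add: sum.distrib)
  also have "(\<Sum>i\<le>N. \<Sum>j\<le>N. of_nat i * g (int i) (int j) * M (i - 1) (Suc j)) =
      (\<Sum>i\<le>N. \<Sum>j\<le>N. of_nat (Suc i) * g (int i + 1) (int j) * M i (Suc j))"
    by (rule sum_shift_up[symmetric])
      (auto simp: g_def gamma_eq_0 N_def algebra_simps
        simp del: sum.atMost_Suc intro!: sum.neutral)
  also have "\<dots> = (\<Sum>i\<le>N. \<Sum>j\<le>N. of_nat (Suc i) * g (int i + 1) (int j - 1) * M i j)"
    by (rule sum.cong[OF refl], rule sum_shift_up) (auto simp: \<gamma>_neg g_def gamma_eq_0 N_def)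
  \<comment> \<open>Replacing \<open>j\<close> by \<open>j - 1\<close> turns
    \<open>n - i - 2 * j\<close> into the coefficient of the recurrence.\<close>
  also have "(\<Sum>i\<le>N. \<Sum>j\<le>N. of_int (int n - int i - 2 * int j) * g (int i) (int j) * M i (Suc j)) =
      (\<Sum>i\<le>N. \<Sum>j\<le>N. of_int (int n - int i - 2 * int j + 2) * g (int i) (int j - 1) * M i j)"
    by (rule sum.cong[OF refl], rule sum_shift_up) (auto simp: \<gamma>_neg g_def gamma_eq_0 N_def)
  finally have 2: "fps_deriv (gamma_sum n u v w) =
      (\<Sum>i\<le>N. \<Sum>j\<le>N. of_nat (Suc i) * g (int i + 1) (int j - 1) * M i j) +
      (\<Sum>i\<le>N. \<Sum>j\<le>N. of_nat j * g (int i) (int j) * M i j) +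
      (\<Sum>i\<le>N. \<Sum>j\<le>N. of_int (int n - int i - 2 * int j + 2) * g (int i) (int j - 1) * M i j)" .
  have "gamma_sum (Suc n) u v w = (\<Sum>i\<le>N. \<Sum>j\<le>N. of_int (\<gamma> (Suc n) (int i) (int j)) * M i j)"
    unfolding M_def by (rule gamma_sum_box) (simp add: N_def)
  also have "\<dots> = (\<Sum>i\<le>N. \<Sum>j\<le>N. g (int i - 1) (int j) * M i j +
      of_nat (Suc i) * g (int i + 1) (int j - 1) * M i j + of_nat j * g (int i) (int j) * M i j +
      of_int (int n - int i - 2 * int j + 2) * g (int i) (int j - 1) * M i j)"
    by (intro sum.cong refl) (simp add: g_def algebra_simps)
  finally show ?thesis
    unfolding 1 2 by (simp only: sum.distrib add.assoc)
qed

section \<open>Solving the flow\<close>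

context flow
begin

text \<open>Equal initial values and the same recursion, \<open>A_Suc\<close> on one side and
  \<open>gamma_sum_Suc\<close> on the other.\<close>

lemma A_eq_gamma_sum: "A (Suc n) X Y S = gamma_sum n (S + Y) (2 * X * Y) (X + Y)"
proof (induction n)
  case 0
  have "{p. p permutes {Suc 0}} = {id}"
    by auto
  then show ?case
    by (simp add: A_def gamma_sum_def basc_def des_def suc_def)
next
  case (Suc n)
  have "gamma_sum (Suc n) (S + Y) (2 * X * Y) (X + Y) =
      (S + Y) * gamma_sum n (S + Y) (2 * X * Y) (X + Y) +
      fps_deriv (gamma_sum n (S + Y) (2 * X * Y) (X + Y))"
    by (rule gamma_sum_Suc) (simp_all add: deriv_X deriv_Y deriv_S algebra_simps)
  with Suc show ?case
    by (simp add: A_Suc add.commute)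
qed

text \<open>Differentiating \<open>A (Suc n) X Y S * G\<close> gives the right-hand side of
  \<open>A_Suc\<close> times \<open>G\<close>.\<close>

lemma nth_deriv_integrating_factor:
  assumes "fps_deriv G = (Y + S) * G"
  shows "fps_nth_deriv n G = A (Suc n) X Y S * G"
proof (induction n)
  case 0
  have "{p. p permutes {Suc 0}} = {id}"
    by auto
  then show ?case
    by (simp add: A_def basc_def des_def suc_def)
next
  case (Suc n)
  then show ?case
    by (simp add: fps_nth_deriv_commute A_Suc assms algebra_simps del: fps_nth_deriv.simps)
qed

end

section \<open>Evaluation at z = 0 and explicit solutions\<close>

lemma A_nth_0: "A n X Y S $ 0 = A n (X $ 0) (Y $ 0) (S $ 0)"
  by (simp add: A_def fps_sum_nth fps_power_zeroth)

text \<open>The constant term is a ring homomorphism, so identities along the flow descend to the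
  initial values.\<close>

lemma gamma_sum_nth_0: "gamma_sum n u v w $ 0 = gamma_sum n (u $ 0) (v $ 0) (w $ 0)"
  by (simp add: gamma_sum_def fps_sum_nth fps_power_zeroth flip: fps_of_int)

text \<open>The difference \<open>Y - X\<close> stays equal to \<open>y - x\<close>, which reduces
  the system to a logistic equation with these solutions; \<open>S - Y\<close> is constant. The
  logarithmic derivative of \<open>fps_exp (y + s) * Q\<^sup>2\<close> is
  \<open>y + s + 2 * (Y - y)\<close>, that is \<open>Y + S\<close>.\<close>

lemma flow_distinct:
  fixes x y s :: "'a::field_char_0"
  assumes "x \<noteq> y"
  defines "Q \<equiv> fps_const (y - x) / (fps_const y * fps_exp x - fps_const x * fps_exp y)"
  defines "X \<equiv> fps_const x * fps_exp y * Q"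
    and "Y \<equiv> fps_const y * fps_exp x * Q"
  defines "S \<equiv> fps_const (s - y) + Y"
  shows "flow X Y S" "X $ 0 = x" "Y $ 0 = y" "S $ 0 = s"
    and "fps_deriv (fps_exp (y + s) * Q\<^sup>2) = (Y + S) * (fps_exp (y + s) * Q\<^sup>2)"
    and "(fps_exp (y + s) * Q\<^sup>2) $ 0 = 1"
proof -
  define E where "E = fps_const y * fps_exp x - fps_const x * fps_exp y"
  have E0: "E $ 0 = y - x"
    by (simp add: E_def)
  then have E0': "E $ 0 \<noteq> 0"
    using assms by simp
  then have En: "E \<noteq> 0"
    by auto
  \<comment> \<open>The constant term \<open>y - x\<close> of \<open>E\<close> is nonzero, so
    \<open>E\<close> is invertible.\<close>
  have Q: "Q = fps_const (y - x) * inverse E"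
    unfolding Q_def E_def[symmetric] using E0' by (rule fps_divide_unit)
  have Q0: "Q $ 0 = 1"
    using assms E0 by (simp add: Q)
  have QE: "Q * E = fps_const y - fps_const x"
    unfolding Q using inverse_mult_eq_1[OF E0'] by (simp add: mult.assoc)
  have YX: "Y = X + fps_const y - fps_const x"
    using QE unfolding X_def Y_def E_def by (simp add: algebra_simps)
  have E': "fps_deriv E = fps_const x * fps_const y * (fps_exp x - fps_exp y)"
    unfolding E_def by (simp add: algebra_simps flip: fps_const_mult)
  have "fps_deriv Q * E + Q * fps_deriv E = 0"
    using arg_cong[OF QE, of fps_deriv] by (simp add: algebra_simps)
  then have "fps_deriv Q * E = Q * (fps_const x * fps_const y * (fps_exp y - fps_exp x))"
    unfolding E' by (simp add: algebra_simps add_eq_0_iff2)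
  \<comment> \<open>Writing \<open>y - x\<close> as \<open>Q * E\<close> exposes a factor
    \<open>E\<close> on the right, to be cancelled.\<close>
  also have "\<dots> = Q * (fps_const y * fps_exp x * (Q * E) - fps_const y * E)"
    unfolding QE unfolding E_def by (simp add: algebra_simps del: fps_const_mult fps_const_sub)
  also have "\<dots> = Q * (Y - fps_const y) * E"
    unfolding Y_def by (simp add: algebra_simps)
  finally have Q': "fps_deriv Q = Q * (Y - fps_const y)"
    using En by simp
  have X': "fps_deriv X = X * Y"
    unfolding X_def by (simp add: Q' algebra_simps del: fps_const_mult)
  have Y': "fps_deriv Y = X * Y"
    using X' unfolding YX by simp
  show "flow X Y S"
    by unfold_locales (simp_all add: X' Y' S_def)
  show "X $ 0 = x" "Y $ 0 = y" "S $ 0 = s"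
    by (simp_all add: X_def Y_def S_def Q0)
  show "(fps_exp (y + s) * Q\<^sup>2) $ 0 = 1"
    by (simp add: Q0 fps_power_zeroth)
  show "fps_deriv (fps_exp (y + s) * Q\<^sup>2) = (Y + S) * (fps_exp (y + s) * Q\<^sup>2)"
    by (simp add: Q' S_def power2_eq_square algebra_simps flip: fps_const_add fps_const_sub)
qed

text \<open>At \<open>x = y\<close> the quotient \<open>Q\<close> degenerates to 0/0. With
  \<open>X = Y\<close> the system becomes the Riccati equation \<open>X' = X\<^sup>2\<close>, solved
  by \<open>x / (1 - x * z)\<close>.\<close>

lemma flow_equal:
  fixes x s :: "'a::field_char_0"
  defines "X \<equiv> fps_const x * inverse (1 - fps_const x * fps_X)"
  shows "flow X X (fps_const (s - x) + X)" "X $ 0 = x"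
proof -
  have "fps_deriv X = X * X"
    unfolding X_def by (simp add: fps_inverse_deriv power2_eq_square algebra_simps)
  then show "flow X X (fps_const (s - x) + X)"
    by unfold_locales simp_all
  show "X $ 0 = x"
    by (simp add: X_def)
qed

lemma ex_flow:
  fixes x y s :: "'a::field_char_0"
  obtains X Y S where "flow X Y S" "X $ 0 = x" "Y $ 0 = y" "S $ 0 = s"
proof (cases "x = y")
  case True
  with flow_equal(1)[of x s] flow_equal(2)[of x] show ?thesis
    by (intro that) auto
next
  case False
  from flow_distinct(1-4)[OF this] show ?thesis
    by (rule that)
qed

text \<open>Constant terms of \<open>A_eq_gamma_sum\<close> along a flow starting at the given
  point, which exists for \<open>x = y\<close> as well.\<close>

lemma A_gamma_expansion:
  fixes x y s :: "'a::field_char_0"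
  shows "A (Suc n) x y s = gamma_sum n (s + y) (2 * x * y) (x + y)"
proof -
  obtain X Y S where "flow X Y S" and 0: "X $ 0 = x" "Y $ 0 = y" "S $ 0 = s"
    by (rule ex_flow)
  then interpret flow X Y S
    by simp
  have "A (Suc n) X Y S $ 0 = gamma_sum n (S + Y) (2 * X * Y) (X + Y) $ 0"
    by (simp add: A_eq_gamma_sum)
  then show ?thesis
    by (simp add: A_nth_0 gamma_sum_nth_0 0)
qed

text \<open>By Taylor's formula the n-th coefficient is the constant term of the n-th derivative
  over n!, and that constant term is \<open>A (Suc n) x y s\<close> because the series starts with
  1.\<close>

lemma A_egf:
  fixes x y s :: "'a::field_char_0"
  assumes "x \<noteq> y"
  shows "Abs_fps (\<lambda>n. A (Suc n) x y s / fact n) =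
    fps_exp (y + s) *
    (fps_const (y - x) / (fps_const y * fps_exp x - fps_const x * fps_exp y))\<^sup>2"
    (is "_ = ?G")
proof (rule fps_ext)
  fix n
  note fl = flow_distinct(1)[OF assms, of s] flow_distinct(2,3)[OF assms]
    flow_distinct(4-6)[OF assms, of s]
  have "fps_nth_deriv n ?G $ 0 = A (Suc n) x y s"
    unfolding flow.nth_deriv_integrating_factor[OF fl(1,5)] fps_mult_nth_0[of "A _ _ _ _"] A_nth_0
      fl(2-4,6)
    by simp
  then show "Abs_fps (\<lambda>n. A (Suc n) x y s / fact n) $ n = ?G $ n"
    by (simp add: fps_deriv_maclauren_0 divide_eq_eq mult.commute)
qed

section \<open>Increasing forests\<close>

text \<open>Labels that increase along arcs increase along paths, and following parents downwards
  must end at \<open>0\<close>, so every vertex is reached from the root.\<close>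

lemma increasing_tree_iff:
  "increasing_tree n T \<longleftrightarrow>
    T \<subseteq> {0..n} \<times> {0..n} \<and> (\<forall>(u, v)\<in>T. u < v) \<and> (\<forall>v\<in>{1..n}. \<exists>!u. (u, v) \<in> T)"
    (is "_ \<longleftrightarrow> ?R")
proof
  assume "increasing_tree n T"
  then have *: "rooted_tree {0..n} 0 T" "\<forall>(u, v)\<in>T\<^sup>+. u < v"
    by (auto simp: increasing_tree_def)
  moreover have "{0..n} - {0} = {1..n}"
    by auto
  moreover have "\<forall>(u, v)\<in>T. u < v"
    using *(2) by blast
  ultimately show ?R
    unfolding rooted_tree_def by simp
next
  assume R: ?R
  then have T_lt: "u < v" if "(u, v) \<in> T" for u v
    using that by blast
  then have no_parent: "\<nexists>u. (u, 0) \<in> T"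
    by auto
  have lt: "u < v" if "(u, v) \<in> T\<^sup>+" for u v
    using that by (induction rule: trancl.induct) (auto dest: T_lt)
  have "(0, v) \<in> T\<^sup>*" if "v \<le> n" for v
    using that
  proof (induction v rule: less_induct)
    case (less v)
    show ?case
    proof (cases "v = 0")
      case False
      then have "v \<in> {1..n}"
        using less.prems by simp
      then obtain u where u: "(u, v) \<in> T"
        using R by blast
      then have "(0, u) \<in> T\<^sup>*"
        using less.IH[of u] T_lt[OF u] less.prems by simp
      then show ?thesis
        using u by (rule rtrancl_into_rtrancl)
    qed simp
  qed
  moreover have "{0..n} - {0} = {1..n}"
    by auto
  ultimately have "rooted_tree {0..n} 0 T"
    using R no_parent unfolding rooted_tree_def by simp
  with lt show "increasing_tree n T"
    by (auto simp: increasing_tree_def)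
qed

lemma increasing_tree_0_iff: "increasing_tree 0 T \<longleftrightarrow> T = {}"
proof
  assume "increasing_tree 0 T"
  then have "T \<subseteq> {(0, 0)}" "(0, 0) \<notin> T"
    by (auto simp: increasing_tree_iff)
  then show "T = {}"
    by auto
qed (simp add: increasing_tree_iff)

section \<open>Growing increasing trees by their largest vertex\<close>

lemma increasing_treeD:
  assumes "increasing_tree n T" "(u, v) \<in> T"
  shows "u < v" "v \<le> n"
proof -
  have "T \<subseteq> {0..n} \<times> {0..n}" "\<forall>(u, v)\<in>T. u < v"
    using assms(1) by (simp_all add: increasing_tree_iff)
  then show "u < v" "v \<le> n"
    using assms(2) by auto
qed

lemma finite_increasing_trees: "finite {T. increasing_tree n T}"
  by (rule finite_subset[of _ "Pow ({0..n} \<times> {0..n})"])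
    (simp_all add: increasing_tree_iff Collect_mono subset_eq)

lemma increasing_tree_insert:
  assumes "increasing_tree n T" "p \<le> n"
  shows "increasing_tree (Suc n) (insert (p, Suc n) T)"
proof -
  have nT: "(u, Suc n) \<notin> T" for u
    using increasing_treeD(2)[OF assms(1)] by fastforce
  have "\<exists>!u. (u, v) \<in> insert (p, Suc n) T" if "v \<in> {1..Suc n}" for v
  proof (cases "v = Suc n")
    case True
    then show ?thesis using nT by auto
  next
    case False
    then have "v \<in> {1..n}" using that by auto
    then have "\<exists>!u. (u, v) \<in> T" using assms(1) by (simp add: increasing_tree_iff)
    then show ?thesis using False by simp
  qed
  moreover have "T \<subseteq> {0..n} \<times> {0..n}" "\<forall>(u, v)\<in>T. u < v"
    using assms(1) by (simp_all add: increasing_tree_iff)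
  then have "insert (p, Suc n) T \<subseteq> {0..Suc n} \<times> {0..Suc n}" "\<forall>(u, v)\<in>insert (p, Suc n) T. u < v"
    using assms(2) by auto
  ultimately show ?thesis
    by (simp only: increasing_tree_iff) blast
qed

text \<open>The largest vertex has no children, so deleting it leaves an increasing tree.\<close>

lemma increasing_tree_Suc_cases:
  assumes T: "increasing_tree (Suc n) T"
  obtains p T' where "T = insert (p, Suc n) T'" "increasing_tree n T'" "p \<le> n"
proof -
  have R: "T \<subseteq> {0..Suc n} \<times> {0..Suc n}" "\<And>u v. (u, v) \<in> T \<Longrightarrow> u < v"
    "\<And>v. v \<in> {1..Suc n} \<Longrightarrow> \<exists>!u. (u, v) \<in> T"
    using T[unfolded increasing_tree_iff] by blast+
  obtain p where p: "(p, Suc n) \<in> T" "\<And>u. (u, Suc n) \<in> T \<Longrightarrow> u = p"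
    using R(3)[of "Suc n"] by auto
  define T' where "T' = T - {(p, Suc n)}"
  have v: "v \<le> n \<and> u < v" if "(u, v) \<in> T'" for u v
  proof -
    have "v \<noteq> Suc n"
      using that p(2) unfolding T'_def by auto
    then show ?thesis
      using that R(1,2) unfolding T'_def by fastforce
  qed
  have "\<exists>!u. (u, v) \<in> T'" if "v \<in> {1..n}" for v
    using R(3)[of v] that unfolding T'_def by simp
  moreover have "T' \<subseteq> {0..n} \<times> {0..n}"
    using v by fastforce
  ultimately have "increasing_tree n T'"
    using v by (simp add: increasing_tree_iff case_prod_unfold)
  moreover have "T = insert (p, Suc n) T'" "p \<le> n"
    using p(1) R(2)[OF p(1)] unfolding T'_def by (simp_all add: insert_absorb)
  ultimately show ?thesis
    using that by blast
qed

text \<open>Only the inserted arc ends at \<open>Suc n\<close>, so both the parent and the smaller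
  tree can be read off.\<close>

lemma increasing_tree_insert_inject:
  assumes "increasing_tree n T" "increasing_tree n T'"
    and "insert (p, Suc n) T = insert (q, Suc n) T'"
  shows "T = T' \<and> p = q"
proof -
  have "(u, Suc n) \<notin> T" "(u, Suc n) \<notin> T'" for u
    using increasing_treeD(2)[OF assms(1)] increasing_treeD(2)[OF assms(2)] by fastforce+
  then show ?thesis
    using assms(3) by (metis Pair_inject insertE insertI1 insert_ident)
qed

section \<open>Degrees and the number of open vertices\<close>

lemma children_insert:
  "children (insert (p, m) T) u = (if u = p then insert m (children T u) else children T u)"
  by (auto simp: children_def)

lemma children_bounds: "increasing_tree n T \<Longrightarrow> children T u \<subseteq> {Suc u..n}"
  by (auto simp: children_def Suc_le_eq intro: increasing_treeD)

lemma finite_children: "increasing_tree n T \<Longrightarrow> finite (children T u)"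
  by (rule finite_subset[OF children_bounds]) auto

text \<open>The sets of children partition the non-root vertices.\<close>

lemma sum_vdegree:
  assumes T: "increasing_tree n T"
  shows "(\<Sum>u\<in>{0..n}. vdegree T u) = n"
proof -
  have ex1: "\<exists>!u. (u, v) \<in> T" if "v \<in> {1..n}" for v
    using T that by (simp add: increasing_tree_iff)
  have "(\<Sum>u\<in>{0..n}. vdegree T u) = card (\<Union>u\<in>{0..n}. children T u)"
    unfolding vdegree_def
  proof (rule card_UN_disjoint[symmetric])
    have False if "u \<noteq> u'" "v \<in> children T u" "v \<in> children T u'" for u u' v
    proof -
      have "v \<in> {1..n}"
        using that(2) children_bounds[OF T, of u] by auto
      then show False
        using that ex1[of v] by (auto simp: children_def)
    qed
    then show "\<forall>u\<in>{0..n}. \<forall>u'\<in>{0..n}. u \<noteq> u' \<longrightarrow> children T u \<inter> children T u' = {}"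
      by blast
  qed (simp_all add: finite_children[OF T])
  also have "(\<Union>u\<in>{0..n}. children T u) = {1..n}"
  proof (intro equalityI subsetI)
    fix v assume "v \<in> (\<Union>u\<in>{0..n}. children T u)"
    then obtain u where "v \<in> children T u"
      by blast
    then show "v \<in> {1..n}"
      using children_bounds[OF T, of u] by auto
  next
    fix v assume v: "v \<in> {1..n}"
    then obtain u where u: "(u, v) \<in> T"
      using ex1 by blast
    then have "u \<in> {0..n}"
      using v increasing_treeD(1)[OF T u] by simp
    with u show "v \<in> (\<Union>u\<in>{0..n}. children T u)"
      by (auto simp: children_def)
  qed
  finally show ?thesis by simp
qed

text \<open>The vertices with one child that can still receive another one.\<close>

definition open_unary :: "nat \<Rightarrow> (nat \<times> nat) set \<Rightarrow> nat set" where
  "open_unary n T = {v \<in> {1..n} - children T 0. vdegree T v = 1}"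

lemma forest_increasing: "forest_012 n T \<Longrightarrow> increasing_tree n T"
  by (simp add: forest_012_def)

text \<open>Compare the number of vertices with the sum of the degrees: both equal \<open>n\<close>.\<close>

lemma card_open_unary:
  assumes F: "forest_012 n T"
  shows "int (card (open_unary n T)) =
    int n - int (card (leaves n T \<inter> children T 0)) - 2 * int (card (leaves n T - children T 0))"
proof -
  note T = forest_increasing[OF F]
  let ?d = "vdegree T" and ?C = "children T 0"
  have C: "?C \<subseteq> {1..n}" "finite ?C"
    using children_bounds[OF T, of 0] finite_children[OF T] by auto
  have "{0..n} = insert 0 ({1..n} - ?C \<union> ?C)"
    using C by auto
  then have "int n = int (\<Sum>u\<in>insert 0 ({1..n} - ?C \<union> ?C). ?d u)"
    using sum_vdegree[OF T] by simp
  also have "\<dots> = int (card ?C) + (\<Sum>u\<in>{1..n} - ?C. int (?d u)) + (\<Sum>u\<in>?C. int (?d u))"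
  proof -
    have "0 \<notin> {1..n} - ?C \<union> ?C"
      using C by auto
    moreover have "finite ({1..n} - ?C \<union> ?C)"
      using C by simp
    moreover have "(\<Sum>u\<in>{1..n} - ?C \<union> ?C. ?d u) = (\<Sum>u\<in>{1..n} - ?C. ?d u) + (\<Sum>u\<in>?C. ?d u)"
      using C by (intro sum.union_disjoint) auto
    ultimately show ?thesis
      by (simp add: vdegree_def[of T 0] sum.insert)
  qed
  \<comment> \<open>A degree in \<open>{0, 1, 2}\<close> is 2, less 2 for a leaf and less 1 for a
    vertex with a single child.\<close>
  also have "(\<Sum>u\<in>{1..n} - ?C. int (?d u)) =
      (\<Sum>u\<in>{1..n} - ?C. 2 - 2 * of_bool (u \<in> leaves n T) - of_bool (u \<in> open_unary n T))"
  proof (rule sum.cong[OF refl])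
    fix u assume u: "u \<in> {1..n} - ?C"
    then have "?d u \<le> 2"
      using F by (simp add: forest_012_def)
    then have "?d u = 0 \<or> ?d u = 1 \<or> ?d u = 2"
      by auto
    then show "int (?d u) = 2 - 2 * of_bool (u \<in> leaves n T) - of_bool (u \<in> open_unary n T)"
      using u by (auto simp: leaves_def open_unary_def)
  qed
  also have "\<dots> = 2 * int (card ({1..n} - ?C)) - 2 * int (card (leaves n T - ?C)) -
      int (card (open_unary n T))"
  proof -
    have "({1..n} - ?C) \<inter> {u. u \<in> leaves n T} = leaves n T - ?C"
      "({1..n} - ?C) \<inter> {u. u \<in> open_unary n T} = open_unary n T"
      by (auto simp: leaves_def open_unary_def)
    then show ?thesis
      by (simp add: sum_subtractf sum.If_cases of_bool_def flip: sum_distrib_left)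
  qed
  also have "(\<Sum>u\<in>?C. int (?d u)) = (\<Sum>u\<in>?C. 1 - of_bool (u \<in> leaves n T))"
  proof (rule sum.cong[OF refl])
    fix u assume u: "u \<in> ?C"
    then have "?d u \<in> {0, 1}"
      using F by (simp add: forest_012_def)
    then show "int (?d u) = 1 - of_bool (u \<in> leaves n T)"
      using u C by (auto simp: leaves_def)
  qed
  also have "\<dots> = int (card ?C) - int (card (leaves n T \<inter> ?C))"
    using C(2) by (simp add: sum_subtractf sum.If_cases of_bool_def Int_commute Int_def)
  also have "int (card ({1..n} - ?C)) = int n - int (card ?C)"
    using C card_mono[of "{1..n}" ?C] by (simp add: card_Diff_subset)
  \<comment> \<open>\<open>card ?C\<close> cancels: it occurs once for the root, twice negatively
    for the vertices outside \<open>?C\<close>, and once for those inside.\<close>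
  finally show ?thesis by simp
qed

section \<open>Attaching the largest vertex to a forest\<close>

lemma vdegree_insert:
  assumes "increasing_tree n T"
  shows "vdegree (insert (p, Suc n) T) u = (if u = p then Suc (vdegree T u) else vdegree T u)"
proof -
  have "Suc n \<notin> children T u"
    using children_bounds[OF assms, of u] by auto
  then show ?thesis
    using finite_children[OF assms] by (auto simp: vdegree_def children_insert)
qed

lemma vdegree_new:
  assumes "increasing_tree n T"
  shows "vdegree T (Suc n) = 0"
  using children_bounds[OF assms, of "Suc n"] by (simp add: vdegree_def)

lemma leaves_subset: "leaves n T \<subseteq> {1..n}"
  by (auto simp: leaves_def)

lemma leaves_insert:
  assumes "increasing_tree n T" "p \<le> n"
  shows "leaves (Suc n) (insert (p, Suc n) T) = insert (Suc n) (leaves n T - {p})"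
  using assms by (auto simp: leaves_def vdegree_insert vdegree_new le_Suc_eq)

text \<open>Only the degree of \<open>p\<close> rises, so \<open>p\<close> needs room for one more
  child: the root always has it, a child of the root only if it is a leaf, any other vertex if its
  degree is at most 1.\<close>

lemma forest_insert_iff:
  assumes T: "increasing_tree n T" and p: "p \<le> n"
  shows "forest_012 (Suc n) (insert (p, Suc n) T) \<longleftrightarrow>
    forest_012 n T \<and> p \<in> {0} \<union> leaves n T \<union> open_unary n T"
proof -
  have C: "children T 0 \<subseteq> {1..n}"
    using children_bounds[OF T, of 0] by simp
  have nn: "\<not> p = Suc n" "Suc n \<notin> children T 0"
    using C p by auto
  have dom: "{0..Suc n} - {0} = insert (Suc n) {1..n}" "{0..n} - {0} = {1..n}"
    by auto
  have "forest_012 (Suc n) (insert (p, Suc n) T) \<longleftrightarrow>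
    (\<forall>v\<in>children T 0. vdegree T v + of_bool (v = p) \<le> 1) \<and>
    (\<forall>v\<in>{1..n}. vdegree T v + of_bool (v = p) \<le> 2)"
    unfolding forest_012_def dom using nn increasing_tree_insert[OF T p]
    by (auto simp: children_insert vdegree_insert[OF T] vdegree_new[OF T] le_Suc_eq)
  also have "\<dots> \<longleftrightarrow> forest_012 n T \<and> p \<in> {0} \<union> leaves n T \<union> open_unary n T"
  proof
    assume L: "(\<forall>v\<in>children T 0. vdegree T v + of_bool (v = p) \<le> 1) \<and>
      (\<forall>v\<in>{1..n}. vdegree T v + of_bool (v = p) \<le> 2)"
    then have "\<forall>v\<in>children T 0. vdegree T v \<le> 1" "\<forall>v\<in>{1..n}. vdegree T v \<le> 2"
      by (meson add_leE)+
    then have "forest_012 n T"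
      unfolding forest_012_def dom using T by (auto simp: le_Suc_eq)
    moreover have "p \<in> {0} \<union> leaves n T \<union> open_unary n T"
    proof (cases "p = 0 \<or> vdegree T p = 0")
      case True
      then show ?thesis using p by (auto simp: leaves_def)
    next
      case False
      then have "p \<in> {1..n}" using p by auto
      then have "vdegree T p = 1" "p \<notin> children T 0"
        using L False by force+
      then show ?thesis
        using \<open>p \<in> {1..n}\<close> by (simp add: open_unary_def)
    qed
    ultimately show "forest_012 n T \<and> p \<in> {0} \<union> leaves n T \<union> open_unary n T" ..
  next
    assume R: "forest_012 n T \<and> p \<in> {0} \<union> leaves n T \<union> open_unary n T"
    then have d: "\<forall>v\<in>children T 0. vdegree T v \<le> 1" "\<forall>v\<in>{1..n}. vdegree T v \<le> 2"
      unfolding forest_012_def dom by force+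
    have "vdegree T p = 0" if "p \<in> children T 0"
      using that R C by (auto simp: leaves_def open_unary_def)
    moreover have "vdegree T p \<le> 1" if "p \<noteq> 0"
      using that R by (auto simp: leaves_def open_unary_def)
    ultimately show "(\<forall>v\<in>children T 0. vdegree T v + of_bool (v = p) \<le> 1) \<and>
      (\<forall>v\<in>{1..n}. vdegree T v + of_bool (v = p) \<le> 2)"
      using d by (auto simp: of_bool_def)
  qed
  finally show ?thesis .
qed

section \<open>Counting forests by their two kinds of leaves\<close>

definition root_leaves :: "nat \<Rightarrow> (nat \<times> nat) set \<Rightarrow> nat set" where
  "root_leaves n T = leaves n T \<inter> children T 0"

definition inner_leaves :: "nat \<Rightarrow> (nat \<times> nat) set \<Rightarrow> nat set" where
  "inner_leaves n T = leaves n T - children T 0"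

text \<open>Integer indices, as for \<open>\<gamma>\<close>, make the shifted indices meaningful: a
  negative one gives the empty family.\<close>

definition forests :: "nat \<Rightarrow> int \<Rightarrow> int \<Rightarrow> (nat \<times> nat) set set" where
  "forests n i j = {T. forest_012 n T \<and> int (card (root_leaves n T)) = i \<and>
     int (card (inner_leaves n T)) = j}"

lemma finite_leaves [simp]: "finite (leaves n T)"
  by (simp add: leaves_def)

lemma finite_slots [simp]:
  "finite (root_leaves n T)" "finite (inner_leaves n T)" "finite (open_unary n T)"
  by (simp_all add: root_leaves_def inner_leaves_def open_unary_def)

lemma finite_forests [simp]: "finite (forests n i j)"
  by (rule finite_subset[OF _ finite_increasing_trees[of n]])
    (auto simp: forests_def forest_increasing)

lemma slots_disjoint:
  "0 \<notin> root_leaves n T" "0 \<notin> inner_leaves n T" "0 \<notin> open_unary n T"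
  "root_leaves n T \<inter> inner_leaves n T = {}" "root_leaves n T \<inter> open_unary n T = {}"
  "inner_leaves n T \<inter> open_unary n T = {}"
  by (auto simp: root_leaves_def inner_leaves_def open_unary_def leaves_def)

lemma slots_le:
  assumes "p \<in> {0} \<union> root_leaves n T \<union> inner_leaves n T \<union> open_unary n T"
  shows "p \<le> n"
  using assms by (auto simp: root_leaves_def inner_leaves_def open_unary_def leaves_def)

lemma root_leaves_insert:
  assumes "increasing_tree n T" "p \<le> n"
  shows "root_leaves (Suc n) (insert (p, Suc n) T) =
    (if p = 0 then insert (Suc n) (root_leaves n T) else root_leaves n T - {p})"
  using children_bounds[OF assms(1), of 0] leaves_subset[of n T]
  by (auto simp: root_leaves_def leaves_insert[OF assms] children_insert)

lemma inner_leaves_insert: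
  assumes "increasing_tree n T" "p \<le> n"
  shows "inner_leaves (Suc n) (insert (p, Suc n) T) =
    (if p = 0 then inner_leaves n T else insert (Suc n) (inner_leaves n T - {p}))"
  using children_bounds[OF assms(1), of 0] leaves_subset[of n T]
  by (auto simp: inner_leaves_def leaves_insert[OF assms] children_insert)

text \<open>The two leaf counts change by (1, 0) if \<open>p\<close> is the root, by (-1, 1) if it
  is a root leaf, by (0, 0) if it is an inner leaf and by (0, 1) if it is an open unary vertex; the
  indices of the smaller forest undo this change.\<close>

lemma insert_mem_forests_iff:
  assumes T: "increasing_tree n T" and p: "p \<le> n"
  shows "insert (p, Suc n) T \<in> forests (Suc n) i j \<longleftrightarrow>
    T \<in> forests n (i - 1) j \<and> p = 0 \<or>
    T \<in> forests n (i + 1) (j - 1) \<and> p \<in> root_leaves n T \<or>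
    T \<in> forests n i j \<and> p \<in> inner_leaves n T \<or>
    T \<in> forests n i (j - 1) \<and> p \<in> open_unary n T"
proof -
  note D = slots_disjoint[of n T]
  have new: "Suc n \<notin> root_leaves n T" "Suc n \<notin> inner_leaves n T"
    by (auto simp: root_leaves_def inner_leaves_def leaves_def)
  have iff: "forest_012 (Suc n) (insert (p, Suc n) T) \<longleftrightarrow>
    forest_012 n T \<and> (p = 0 \<or> p \<in> root_leaves n T \<or> p \<in> inner_leaves n T \<or> p \<in> open_unary n T)"
    unfolding forest_insert_iff[OF T p] root_leaves_def inner_leaves_def by auto
  have rm: "int (card (V - {p})) = int (card V) - 1" if "p \<in> V" "finite V" for V
    using that card_Suc_Diff1[of V p] by linarith
  consider "p = 0" | "p \<noteq> 0" "p \<in> root_leaves n T" | "p \<noteq> 0" "p \<in> inner_leaves n T"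
    | "p \<noteq> 0" "p \<in> open_unary n T"
    | "p \<noteq> 0" "p \<notin> root_leaves n T" "p \<notin> inner_leaves n T" "p \<notin> open_unary n T"
    by blast
  then show ?thesis
  proof cases
    case 1
    then show ?thesis
      using D new unfolding forests_def mem_Collect_eq iff root_leaves_insert[OF T p]
        inner_leaves_insert[OF T p]
      by auto
  next
    case 2
    then have "p \<notin> inner_leaves n T" "p \<notin> open_unary n T"
      using D by auto
    with 2 show ?thesis
      using new unfolding forests_def mem_Collect_eq iff root_leaves_insert[OF T p]
        inner_leaves_insert[OF T p]
      by (auto simp: rm simp del: card_Diff_insert)
  next
    case 3
    then have "p \<notin> root_leaves n T" "p \<notin> open_unary n T"
      using D by auto
    with 3 show ?thesis
      using new unfolding forests_def mem_Collect_eq iff root_leaves_insert[OF T p]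
        inner_leaves_insert[OF T p]
      by (auto simp: rm simp del: card_Diff_insert)
  next
    case 4
    then have "p \<notin> root_leaves n T" "p \<notin> inner_leaves n T"
      using D by auto
    with 4 show ?thesis
      using new unfolding forests_def mem_Collect_eq iff root_leaves_insert[OF T p]
        inner_leaves_insert[OF T p]
      by auto
  next
    case 5
    then show ?thesis
      unfolding forests_def mem_Collect_eq iff by auto
  qed
qed

lemma card_forests_Suc:
  "int (card (forests (Suc n) i j)) =
    int (card (forests n (i - 1) j)) + (1 + i) * int (card (forests n (i + 1) (j - 1))) +
    j * int (card (forests n i j)) + (int n - i - 2 * j + 2) * int (card (forests n i (j - 1)))"
proof -
  \<comment> \<open>Each of the four sets below pairs smaller forests with their admissible parents
    of one kind; \<open>f\<close> attaches the new vertex.\<close>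
  define f where "f = (\<lambda>(T, p). insert (p, Suc n) (T :: (nat \<times> nat) set))"
  define Z1 where "Z1 = (SIGMA T:forests n (i - 1) j. {0::nat})"
  define Z2 where "Z2 = Sigma (forests n (i + 1) (j - 1)) (root_leaves n)"
  define Z3 where "Z3 = Sigma (forests n i j) (inner_leaves n)"
  define Z4 where "Z4 = Sigma (forests n i (j - 1)) (open_unary n)"
  note Z_defs = Z1_def Z2_def Z3_def Z4_def
  have Z: "increasing_tree n T \<and> p \<le> n" if "(T, p) \<in> Z1 \<union> Z2 \<union> Z3 \<union> Z4" for T p
  proof -
    have "p \<in> {0} \<union> root_leaves n T \<union> inner_leaves n T \<union> open_unary n T"
      using that unfolding Z_defs by auto
    moreover have "increasing_tree n T"
      using that unfolding Z_defs forests_def by (auto intro: forest_increasing)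
    ultimately show ?thesis
      using slots_le by blast
  qed
  have "forests (Suc n) i j = f ` (Z1 \<union> Z2 \<union> Z3 \<union> Z4)"
  proof (intro equalityI subsetI)
    fix T assume T: "T \<in> forests (Suc n) i j"
    then have "increasing_tree (Suc n) T"
      by (simp add: forests_def forest_increasing)
    then obtain p T' where *: "T = insert (p, Suc n) T'" "increasing_tree n T'" "p \<le> n"
      by (rule increasing_tree_Suc_cases)
    then have "(T', p) \<in> Z1 \<union> Z2 \<union> Z3 \<union> Z4"
      using T unfolding *(1) insert_mem_forests_iff[OF *(2,3)] Z_defs by auto
    then show "T \<in> f ` (Z1 \<union> Z2 \<union> Z3 \<union> Z4)"
      using *(1) by (force simp: f_def)
  next
    fix T assume "T \<in> f ` (Z1 \<union> Z2 \<union> Z3 \<union> Z4)"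
    then obtain T' p where *: "T = insert (p, Suc n) T'" "(T', p) \<in> Z1 \<union> Z2 \<union> Z3 \<union> Z4"
      by (auto simp: f_def)
    show "T \<in> forests (Suc n) i j"
      using *(2) Z[OF *(2)] unfolding *(1) by (subst insert_mem_forests_iff) (auto simp: Z_defs)
  qed
  moreover have "inj_on f (Z1 \<union> Z2 \<union> Z3 \<union> Z4)"
  proof (rule inj_onI, clarify)
    fix T p T' p' assume "(T, p) \<in> Z1 \<union> Z2 \<union> Z3 \<union> Z4" "(T', p') \<in> Z1 \<union> Z2 \<union> Z3 \<union> Z4"
      and "f (T, p) = f (T', p')"
    then show "T = T' \<and> p = p'"
      using Z increasing_tree_insert_inject[of n T T' p p'] by (simp add: f_def)
  qed
  ultimately have "card (forests (Suc n) i j) = card (Z1 \<union> Z2 \<union> Z3 \<union> Z4)"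
    by (simp add: card_image)
  also have "\<dots> = card Z1 + card Z2 + card Z3 + card Z4"
  proof -
    have "finite Z1" "finite Z2" "finite Z3" "finite Z4"
      unfolding Z_defs by auto
    moreover have "Z1 \<inter> Z2 = {}" "(Z1 \<union> Z2) \<inter> Z3 = {}" "(Z1 \<union> Z2 \<union> Z3) \<inter> Z4 = {}"
      unfolding Z_defs root_leaves_def inner_leaves_def open_unary_def leaves_def by auto
    ultimately show ?thesis
      by (simp add: card_Un_disjoint)
  qed
  finally have "int (card (forests (Suc n) i j)) =
    int (card Z1) + int (card Z2) + int (card Z3) + int (card Z4)"
    by simp
  moreover have "int (card Z1) = int (card (forests n (i - 1) j))"
    by (simp add: Z1_def)
  moreover have "int (card Z2) = (1 + i) * int (card (forests n (i + 1) (j - 1)))"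
  proof -
    have "int (card Z2) = (\<Sum>T\<in>forests n (i + 1) (j - 1). int (card (root_leaves n T)))"
      by (simp add: Z2_def)
    also have "\<dots> = (\<Sum>T\<in>forests n (i + 1) (j - 1). 1 + i)"
      by (intro sum.cong) (auto simp: forests_def)
    finally show ?thesis by simp
  qed
  moreover have "int (card Z3) = j * int (card (forests n i j))"
  proof -
    have "int (card Z3) = (\<Sum>T\<in>forests n i j. int (card (inner_leaves n T)))"
      by (simp add: Z3_def)
    also have "\<dots> = (\<Sum>T\<in>forests n i j. j)"
      by (intro sum.cong) (auto simp: forests_def)
    finally show ?thesis by simp
  qed
  moreover have "int (card Z4) = (int n - i - 2 * j + 2) * int (card (forests n i (j - 1)))"
  proof -
    have "int (card Z4) = (\<Sum>T\<in>forests n i (j - 1). int (card (open_unary n T)))"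
      by (simp add: Z4_def)
    \<comment> \<open>These forests have \<open>j - 1\<close> inner leaves, so
      \<open>card_open_unary\<close> gives \<open>n - i - 2 * (j - 1)\<close>.\<close>
    also have "\<dots> = (\<Sum>T\<in>forests n i (j - 1). int n - i - 2 * j + 2)"
      by (intro sum.cong) (auto simp: forests_def card_open_unary root_leaves_def inner_leaves_def)
    finally show ?thesis by simp
  qed
  ultimately show ?thesis by simp
qed

lemma gamma_eq_card_forests: "\<gamma> n i j = int (card (forests n i j))"
proof (induction n arbitrary: i j)
  case 0
  \<comment> \<open>The single vertex \<open>0\<close> carries only the empty tree, and the root
    never counts as a leaf.\<close>
  have "forest_012 0 T \<longleftrightarrow> T = {}" for T
    by (auto simp: forest_012_def increasing_tree_0_iff children_def)
  then have "forests 0 i j = (if i = 0 \<and> j = 0 then {{}} else {})"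
    by (auto simp: forests_def root_leaves_def inner_leaves_def leaves_def)
  then show ?case by simp
next
  case (Suc n)
  show ?case
  proof (cases "i < 0 \<or> j < 0")
    case True
    then have "forests (Suc n) i j = {}"
      by (auto simp: forests_def)
    with True show ?thesis by simp
  next
    case False
    then show ?thesis
      by (simp add: card_forests_Suc Suc)
  qed
qed

lemma forests_eq:
  "forests n (int i) (int j) = {T. forest_012 n T \<and> card (leaves n T) = i + j \<and>
     card (leaves n T \<inter> children T 0) = i}"
proof -
  have "card (leaves n T) = card (root_leaves n T) + card (inner_leaves n T)" for T
    unfolding root_leaves_def inner_leaves_def by (simp add: card_Int_Diff)
  then show ?thesis
    by (auto simp: forests_def root_leaves_def)
qed

text \<open>At \<open>x = y\<close> numerator and denominator in (i) are both zero, whence the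
  condition there; (ii) holds at every point.\<close>

theorem theorem3p2:
  fixes x y s :: "'a::field_char_0"
  shows
    "(x \<noteq> y \<longrightarrow>
       Abs_fps (\<lambda>n. A (n + 1) x y s / fact n) =
         fps_exp (y + s) *
         (fps_const (y - x) / (fps_const y * fps_exp x - fps_const x * fps_exp y))\<^sup>2) \<and>
     (\<forall>n. A (n + 1) x y s =
       (\<Sum>i=0..n. (s + y) ^ i *
         (\<Sum>j=0..(n - i) div 2.
            of_int (\<gamma> n (int i) (int j)) * (2 * x * y) ^ j * (x + y) ^ (n - i - 2 * j)))) \<and>
     (\<forall>n i j :: nat. \<gamma> n (int i) (int j) =
       int (card {T. forest_012 n T \<and> card (leaves n T) = i + j \<and>
                     card (leaves n T \<inter> children T 0) = i}))"
proof (intro conjI impI allI)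
  assume "x \<noteq> y"
  from A_egf[OF this, of s]
  show "Abs_fps (\<lambda>n. A (n + 1) x y s / fact n) =
      fps_exp (y + s) *
      (fps_const (y - x) / (fps_const y * fps_exp x - fps_const x * fps_exp y))\<^sup>2"
    by simp
next
  fix n
  from A_gamma_expansion[of n x y s]
  show "A (n + 1) x y s =
      (\<Sum>i=0..n. (s + y) ^ i *
        (\<Sum>j=0..(n - i) div 2.
           of_int (\<gamma> n (int i) (int j)) * (2 * x * y) ^ j * (x + y) ^ (n - i - 2 * j)))"
    by (simp add: gamma_sum_def)
next
  fix n i j :: nat
  show "\<gamma> n (int i) (int j) =
      int (card {T. forest_012 n T \<and> card (leaves n T) = i + j \<and>
                    card (leaves n T \<inter> children T 0) = i})"
    by (simp only: gamma_eq_card_forests forests_eq)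
qed

end
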